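(* Let $\mathbb{X}$ be a restriction category with restriction zeroes. There is a bijective correspondence between interference relations on (maps of) $\mathbb{X}$ and restrictional interference relations on $\mathbb{X}$. Explicitly: (i) given an interference relation $\perp$, its restrictional interference relation $\perp^{\mathcal{O}}$ is defined by $e\perp^{\mathcal{O}}e'$ iff $e\perp e'$, for restriction idempotents $e,e'$ on the same object; (ii) given a restrictional interference relation $\perp^{\mathcal{O}}$, its interference relation $\perp$ is defined by $f\perp g$ iff $\overline{f}\perp^{\mathcal{O}}\overline{g}$, for maps $f:A\to B$ and $g:A\to C$.
   Context: Composition is diagrammatic: $fg$ means first $f$, then $g$. A restriction category is a category with an operator sending each $f:A\to B$ to $\overline{f}:A\to A$ such that $\overline{f}f=f$; $\overline{f}\,\overline{g}=\overline{g}\,\overline{f}$ and $\overline{\overline{g}f}=\overline{g}\,\overline{f}$ for $f:A\to B$, $g:A\to C$; and $f\overline{g}=\overline{fg}f$ for $f:A\to B$, $g:B\to C$. For parallel $f,g$: $f\le g$ iff $\overline{f}g=f$ (a partial order). A restriction idempotent is a map $e:A\to A$ with $\overline{e}=e$; $\mathcal{O}(A)$ is the set of these. Restriction zeroes: maps $0:A\to B$ with $f0=0=0f$ and $\overline{0}=0$. An interference relation $\perp$ is a family of relations $\perp^A_{B,C}\subseteq\mathbb{X}(A,B)\times\mathbb{X}(A,C)$ such that: $1_A\perp 0$; $f\perp g\Rightarrow g\perp f$; $f\perp f\Rightarrow f=0$; $f'\perp g'$, $f\le f'$, $g\le g'$ imply $f\perp g$; $f\perp g\Rightarrow hfk\perp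 hgk'$ for all composable $h,k,k'$; $f\perp g\Rightarrow\overline{f}\perp\overline{g}$. A restrictional interference relation is a family of relations $\perp^{\mathcal{O}}_A\subseteq\mathcal{O}(A)\times\mathcal{O}(A)$ such that: $1_A\perp 0$; $e\perp e'\Rightarrow e'\perp e$; $e\perp e\Rightarrow e=0$; $e_1'\perp e_2'$, $e_1\le e_1'$, $e_2\le e_2'$ imply $e_1\perp e_2$; if $e\perp e'$ in $\mathcal{O}(A)$ then $\overline{he}\perp\overline{he'}$ for any $h$ with codomain $A$. *)

theory Defs
  imports Main
begin

text \<open>Composition is written in diagrammatic order: \<open>f \<cdot> g\<close> is first \<open>f\<close>, then \<open>g\<close>.\<close>

record ('o, 'm) category_data =
  Obj :: "'o set"
  Arr :: "'m set"
  Dom :: "'m \<Rightarrow> 'o"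
  Cod :: "'m \<Rightarrow> 'o"
  Ident :: "'o \<Rightarrow> 'm"
  Comp :: "'m \<Rightarrow> 'm \<Rightarrow> 'm" (infixl "\<cdot>\<index>" 70)

definition Hom :: "('o, 'm, 'z) category_data_scheme \<Rightarrow> 'o \<Rightarrow> 'o \<Rightarrow> 'm set" where
  "Hom X A B = {f \<in> Arr X. Dom X f = A \<and> Cod X f = B}"

locale category =
  fixes X (structure)
  assumes Dom_Obj: "f \<in> Arr X \<Longrightarrow> Dom X f \<in> Obj X"
    and Cod_Obj: "f \<in> Arr X \<Longrightarrow> Cod X f \<in> Obj X"
    and Ident_Hom: "A \<in> Obj X \<Longrightarrow> Ident X A \<in> Hom X A A"
    and Comp_Hom: "\<lbrakk>f \<in> Hom X A B; g \<in> Hom X B C\<rbrakk> \<Longrightarrow> f \<cdot> g \<in> Hom X A C"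
    and Ident_left: "f \<in> Hom X A B \<Longrightarrow> Ident X A \<cdot> f = f"
    and Ident_right: "f \<in> Hom X A B \<Longrightarrow> f \<cdot> Ident X B = f"
    and Comp_assoc: "\<lbrakk>f \<in> Hom X A B; g \<in> Hom X B C; h \<in> Hom X C D\<rbrakk>
      \<Longrightarrow> (f \<cdot> g) \<cdot> h = f \<cdot> (g \<cdot> h)"

record ('o, 'm) restriction_data = "('o, 'm) category_data" +
  Rst :: "'m \<Rightarrow> 'm"

locale restriction_category = category X
  for X :: "('o, 'm, 'z) restriction_data_scheme" (structure) +
  assumes Rst_Hom: "f \<in> Hom X A B \<Longrightarrow> Rst X f \<in> Hom X A A"
    and R1: "f \<in> Hom X A B \<Longrightarrow> Rst X f \<cdot> f = f"
    and R2: "\<lbrakk>f \<in> Hom X A B; g \<in> Hom X A C\<rbrakk>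
      \<Longrightarrow> Rst X f \<cdot> Rst X g = Rst X g \<cdot> Rst X f"
    and R3: "\<lbrakk>f \<in> Hom X A B; g \<in> Hom X A C\<rbrakk>
      \<Longrightarrow> Rst X (Rst X g \<cdot> f) = Rst X g \<cdot> Rst X f"
    and R4: "\<lbrakk>f \<in> Hom X A B; g \<in> Hom X B C\<rbrakk>
      \<Longrightarrow> f \<cdot> Rst X g = Rst X (f \<cdot> g) \<cdot> f"

definition restr_le :: "('o, 'm, 'z) restriction_data_scheme \<Rightarrow> 'm \<Rightarrow> 'm \<Rightarrow> bool"
    (infix "\<preceq>\<index>" 50) where
  "f \<preceq>\<^bsub>X\<^esub> g \<longleftrightarrow> (\<exists>A B. f \<in> Hom X A B \<and> g \<in> Hom X A B) \<and> Rst X f \<cdot>\<^bsub>X\<^esub> g = f"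

definition restr_idems :: "('o, 'm, 'z) restriction_data_scheme \<Rightarrow> 'o \<Rightarrow> 'm set" where
  "restr_idems X A = {e \<in> Hom X A A. Rst X e = e}"

record ('o, 'm) restriction_zero_data = "('o, 'm) restriction_data" +
  Zero :: "'o \<Rightarrow> 'o \<Rightarrow> 'm"

locale restriction_zero_category = restriction_category X
  for X :: "('o, 'm, 'z) restriction_zero_data_scheme" (structure) +
  assumes Zero_Hom: "\<lbrakk>A \<in> Obj X; B \<in> Obj X\<rbrakk> \<Longrightarrow> Zero X A B \<in> Hom X A B"
    and Comp_Zero: "\<lbrakk>f \<in> Hom X A B; C \<in> Obj X\<rbrakk> \<Longrightarrow> f \<cdot> Zero X B C = Zero X A C"
    and Zero_Comp: "\<lbrakk>A \<in> Obj X; f \<in> Hom X B C\<rbrakk> \<Longrightarrow> Zero X A B \<cdot> f = Zero X A C"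
    and Rst_Zero: "\<lbrakk>A \<in> Obj X; B \<in> Obj X\<rbrakk> \<Longrightarrow> Rst X (Zero X A B) = Zero X A A"

text \<open>
  A family of relations is a set-valued function of its object indices. Since \<open>Hom X A B\<close> is
  empty unless \<open>A\<close> and \<open>B\<close> are objects, the typing conditions \<open>perp_typed\<close> below make such a
  family empty at all other indices, so that equality of these functions is equality of families
  indexed by objects.
\<close>

locale interference_relation = restriction_zero_category X
  for X :: "('o, 'm, 'z) restriction_zero_data_scheme" (structure) +
  fixes perp :: "'o \<Rightarrow> 'o \<Rightarrow> 'o \<Rightarrow> ('m \<times> 'm) set"
  assumes perp_typed: "perp A B C \<subseteq> Hom X A B \<times> Hom X A C"
    and perp_Zero: "\<lbrakk>A \<in> Obj X; B \<in> Obj X\<rbrakk> \<Longrightarrow> (Ident X A, Zero X A B) \<in> perp A A B"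
    and perp_sym: "(f, g) \<in> perp A B C \<Longrightarrow> (g, f) \<in> perp A C B"
    and perp_self: "(f, f) \<in> perp A B B \<Longrightarrow> f = Zero X A B"
    and perp_down: "\<lbrakk>(f', g') \<in> perp A B C; f \<preceq> f'; g \<preceq> g'\<rbrakk> \<Longrightarrow> (f, g) \<in> perp A B C"
    and perp_Comp: "\<lbrakk>(f, g) \<in> perp A B C; h \<in> Hom X A' A; k \<in> Hom X B B'; k' \<in> Hom X C C'\<rbrakk>
      \<Longrightarrow> (h \<cdot> f \<cdot> k, h \<cdot> g \<cdot> k') \<in> perp A' B' C'"
    and perp_Rst: "(f, g) \<in> perp A B C \<Longrightarrow> (Rst X f, Rst X g) \<in> perp A A A"

locale restrictional_interference_relation = restriction_zero_category X
  for X :: "('o, 'm, 'z) restriction_zero_data_scheme" (structure) +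
  fixes perp :: "'o \<Rightarrow> ('m \<times> 'm) set"
  assumes perp_typed: "perp A \<subseteq> restr_idems X A \<times> restr_idems X A"
    and perp_Zero: "A \<in> Obj X \<Longrightarrow> (Ident X A, Zero X A A) \<in> perp A"
    and perp_sym: "(e, e') \<in> perp A \<Longrightarrow> (e', e) \<in> perp A"
    and perp_self: "(e, e) \<in> perp A \<Longrightarrow> e = Zero X A A"
    and perp_down: "\<lbrakk>(e1', e2') \<in> perp A; e1 \<in> restr_idems X A; e2 \<in> restr_idems X A;
      e1 \<preceq> e1'; e2 \<preceq> e2'\<rbrakk> \<Longrightarrow> (e1, e2) \<in> perp A"
    and perp_Comp: "\<lbrakk>(e, e') \<in> perp A; h \<in> Hom X B A\<rbrakk>
      \<Longrightarrow> (Rst X (h \<cdot> e), Rst X (h \<cdot> e')) \<in> perp B"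

definition to_restrictional ::
  "('o, 'm, 'z) restriction_data_scheme \<Rightarrow> ('o \<Rightarrow> 'o \<Rightarrow> 'o \<Rightarrow> ('m \<times> 'm) set)
    \<Rightarrow> 'o \<Rightarrow> ('m \<times> 'm) set" where
  "to_restrictional X perp A =
    {(e, e'). e \<in> restr_idems X A \<and> e' \<in> restr_idems X A \<and> (e, e') \<in> perp A A A}"

definition of_restrictional ::
  "('o, 'm, 'z) restriction_data_scheme \<Rightarrow> ('o \<Rightarrow> ('m \<times> 'm) set)
    \<Rightarrow> 'o \<Rightarrow> 'o \<Rightarrow> 'o \<Rightarrow> ('m \<times> 'm) set" where
  "of_restrictional X perpO A B C =
    {(f, g). f \<in> Hom X A B \<and> g \<in> Hom X A C \<and> (Rst X f, Rst X g) \<in> perpO A}"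

end

theory Submission
  imports Defs
begin

text \<open>
  The point is that \<open>f \<perp> g\<close> depends only on the restrictions of \<open>f\<close> and \<open>g\<close>: one implication is an
  axiom, and the other follows by composing the restrictions of \<open>f\<close> and \<open>g\<close> with \<open>f\<close> and \<open>g\<close>
  themselves. For the closure under composition of the relation induced on maps one uses that the
  restriction of \<open>h f k\<close> lies below that of \<open>h f\<close>, which is also the restriction of \<open>h\<close> followed by
  the restriction of \<open>f\<close>.
\<close>

context category
begin

lemma Hom_Dom_Obj: "f \<in> Hom X A B \<Longrightarrow> A \<in> Obj X"
  and Hom_Cod_Obj: "f \<in> Hom X A B \<Longrightarrow> B \<in> Obj X"
  using Dom_Obj Cod_Obj by (auto simp: Hom_def)

lemma Hom_unique:
  "\<lbrakk>f \<in> Hom X A B; f \<in> Hom X A' B'\<rbrakk> \<Longrightarrow> A' = A \<and> B' = B"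
  by (simp add: Hom_def)

end

context restriction_category
begin

lemma Rst_Ident: "A \<in> Obj X \<Longrightarrow> Rst X (Ident X A) = Ident X A"
  by (metis Ident_Hom Ident_right R1 Rst_Hom)

text \<open>This is the instance of \<open>R3\<close> in which the second factor is an identity,
  whose restriction is again the identity.\<close>

lemma Rst_Rst:
  assumes "f \<in> Hom X A B"
  shows "Rst X (Rst X f) = Rst X f"
  by (metis assms Hom_Dom_Obj Ident_Hom Ident_right R3 Rst_Hom Rst_Ident)

lemma Rst_in_restr_idems: "f \<in> Hom X A B \<Longrightarrow> Rst X f \<in> restr_idems X A"
  by (simp add: restr_idems_def Rst_Hom Rst_Rst)

text \<open>\<open>R2\<close> moves the restriction of \<open>f\<close> to the front,
  \<open>R3\<close> takes it inside the outer restriction, and there \<open>R1\<close> absorbs it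
  into \<open>f\<close>.\<close>

lemma Rst_Comp_absorb:
  assumes "f \<in> Hom X A B" "g \<in> Hom X B C"
  shows "Rst X (f \<cdot> g) \<cdot> Rst X f = Rst X (f \<cdot> g)"
proof -
  have fg: "f \<cdot> g \<in> Hom X A C"
    using assms by (rule Comp_Hom)
  have "Rst X (f \<cdot> g) \<cdot> Rst X f = Rst X f \<cdot> Rst X (f \<cdot> g)"
    using R2[OF fg assms(1)] .
  also have "\<dots> = Rst X (Rst X f \<cdot> (f \<cdot> g))"
    using R3[OF fg assms(1)] by simp
  also have "Rst X f \<cdot> (f \<cdot> g) = f \<cdot> g"
    using Comp_assoc[OF Rst_Hom[OF assms(1)] assms] R1[OF assms(1)] by simp
  finally show ?thesis .
qed

text \<open>\<open>R4\<close> rewrites the inner map to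
  \<open>Rst X (f \<cdot> g) \<cdot> f\<close>, then \<open>R3\<close> and absorption apply. This
  lets the composition axiom for idempotents, used on the restriction of a map, speak about
  composites with the map itself.\<close>

lemma Rst_Comp_Rst:
  assumes "f \<in> Hom X A B" "g \<in> Hom X B C"
  shows "Rst X (f \<cdot> Rst X g) = Rst X (f \<cdot> g)"
  using R4[OF assms] R3[OF assms(1) Comp_Hom[OF assms]] Rst_Comp_absorb[OF assms] by simp

lemma Rst_Comp_le:
  assumes "f \<in> Hom X A B" "g \<in> Hom X B C"
  shows "Rst X (f \<cdot> g) \<preceq> Rst X f"
  unfolding restr_le_def
  using Rst_Hom[OF assms(1)] Rst_Hom[OF Comp_Hom[OF assms]] Rst_Rst[OF Comp_Hom[OF assms]]
    Rst_Comp_absorb[OF assms] by auto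

text \<open>Take restrictions on both sides of \<open>Rst X f \<cdot> g = f\<close> and expand the
  left one by \<open>R3\<close>.\<close>

lemma Rst_mono:
  assumes "f \<preceq> g"
  shows "Rst X f \<preceq> Rst X g"
proof -
  obtain A B where f: "f \<in> Hom X A B" and g: "g \<in> Hom X A B" and "Rst X f \<cdot> g = f"
    using assms by (auto simp: restr_le_def)
  then have "Rst X f \<cdot> Rst X g = Rst X f"
    using R3[OF g f] by simp
  then show ?thesis
    unfolding restr_le_def using Rst_Hom[OF f] Rst_Hom[OF g] Rst_Rst[OF f] by auto
qed

end

context interference_relation
begin

lemma perp_iff_Rst_perp:
  assumes f: "f \<in> Hom X A B" and g: "g \<in> Hom X A C"
  shows "(f, g) \<in> perp A B C \<longleftrightarrow> (Rst X f, Rst X g) \<in> perp A A A"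
proof
  assume "(Rst X f, Rst X g) \<in> perp A A A"
  \<comment> \<open>With \<open>h\<close> an identity only the composition on the right remains, and
    \<open>R1\<close> collapses \<open>Rst X f \<cdot> f\<close> to \<open>f\<close>, likewise for
    \<open>g\<close>.\<close>
  from perp_Comp[OF this Ident_Hom[OF Hom_Dom_Obj[OF f]] f g] show "(f, g) \<in> perp A B C"
    by (simp add: Ident_left[OF Rst_Hom[OF f]] Ident_left[OF Rst_Hom[OF g]] R1[OF f] R1[OF g])
qed (rule perp_Rst)

lemma restrictional_to_restrictional:
  "restrictional_interference_relation X (to_restrictional X perp)"
proof unfold_locales
  fix A
  show "to_restrictional X perp A \<subseteq> restr_idems X A \<times> restr_idems X A"
    by (auto simp: to_restrictional_def)
next
  fix A assume "A \<in> Obj X"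
  then show "(Ident X A, Zero X A A) \<in> to_restrictional X perp A"
    by (simp add: to_restrictional_def restr_idems_def Ident_Hom Rst_Ident Zero_Hom Rst_Zero
        perp_Zero)
next
  fix e e' A assume "(e, e') \<in> to_restrictional X perp A"
  then show "(e', e) \<in> to_restrictional X perp A"
    by (auto simp: to_restrictional_def intro: perp_sym)
next
  fix e A assume "(e, e) \<in> to_restrictional X perp A"
  then show "e = Zero X A A"
    by (auto simp: to_restrictional_def intro: perp_self)
next
  fix e1' e2' A e1 e2
  assume "(e1', e2') \<in> to_restrictional X perp A" "e1 \<in> restr_idems X A" "e2 \<in> restr_idems X A"
    "e1 \<preceq> e1'" "e2 \<preceq> e2'"
  then show "(e1, e2) \<in> to_restrictional X perp A"
    by (auto simp: to_restrictional_def intro: perp_down)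
next
  fix e e' A h B
  assume perp: "(e, e') \<in> to_restrictional X perp A" and h: "h \<in> Hom X B A"
  then have e: "e \<in> Hom X A A" and e': "e' \<in> Hom X A A" and ee': "(e, e') \<in> perp A A A"
    by (auto simp: to_restrictional_def restr_idems_def)
  have he: "h \<cdot> e \<in> Hom X B A" and he': "h \<cdot> e' \<in> Hom X B A"
    using Comp_Hom[OF h e] Comp_Hom[OF h e'] by auto
  \<comment> \<open>Identities on the right reduce \<open>perp_Comp\<close> to precomposition with
    \<open>h\<close>; \<open>perp_Rst\<close> then passes to the restrictions.\<close>
  have 1: "Ident X A \<in> Hom X A A"
    using Ident_Hom[OF Hom_Cod_Obj[OF h]] .
  have "(h \<cdot> e, h \<cdot> e') \<in> perp B A A"
    using perp_Comp[OF ee' h 1 1] by (simp add: Ident_right[OF he] Ident_right[OF he'])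
  then show "(Rst X (h \<cdot> e), Rst X (h \<cdot> e')) \<in> to_restrictional X perp B"
    by (simp add: to_restrictional_def Rst_in_restr_idems[OF he] Rst_in_restr_idems[OF he']
        perp_Rst)
qed

lemma of_to_restrictional: "of_restrictional X (to_restrictional X perp) = perp"
proof (intro ext set_eqI)
  fix A B C p
  show "p \<in> of_restrictional X (to_restrictional X perp) A B C \<longleftrightarrow> p \<in> perp A B C"
    \<comment> \<open>Typing confines \<open>perp\<close> to the pairs of maps that
      \<open>of_restrictional\<close> admits. On these, membership is decided by the restrictions,
      which always pass the idempotency test in \<open>to_restrictional\<close>.\<close>
    using perp_typed[of A B C] perp_iff_Rst_perp[of "fst p" A B "snd p" C]
    by (cases p) (auto simp: of_restrictional_def to_restrictional_def Rst_in_restr_idems)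
qed

end

context restrictional_interference_relation
begin

lemma interference_of_restrictional:
  "interference_relation X (of_restrictional X perp)"
proof unfold_locales
  fix A B C
  show "of_restrictional X perp A B C \<subseteq> Hom X A B \<times> Hom X A C"
    by (auto simp: of_restrictional_def)
next
  fix A B assume "A \<in> Obj X" "B \<in> Obj X"
  then show "(Ident X A, Zero X A B) \<in> of_restrictional X perp A A B"
    by (simp add: of_restrictional_def Ident_Hom Zero_Hom Rst_Ident Rst_Zero perp_Zero)
next
  fix f g A B C assume "(f, g) \<in> of_restrictional X perp A B C"
  then show "(g, f) \<in> of_restrictional X perp A C B"
    by (auto simp: of_restrictional_def intro: perp_sym)
next
  fix f A B assume "(f, f) \<in> of_restrictional X perp A B B"
  then have f: "f \<in> Hom X A B" and "(Rst X f, Rst X f) \<in> perp A"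
    by (auto simp: of_restrictional_def)
  then have "Rst X f = Zero X A A"
    by (intro perp_self)
  \<comment> \<open>By \<open>R1\<close>, \<open>f\<close> factors through its restriction, and a
    composite that begins with a zero map is zero.\<close>
  then show "f = Zero X A B"
    using R1[OF f] Zero_Comp[OF Hom_Dom_Obj[OF f] f] by simp
next
  fix f' g' A B C f g
  assume perp: "(f', g') \<in> of_restrictional X perp A B C" and le: "f \<preceq> f'" "g \<preceq> g'"
  \<comment> \<open>The order hides its hom-set in an existential; since an arrow has only one
    domain and codomain, it is the hom-set of \<open>f'\<close> or of \<open>g'\<close>.\<close>
  then have f: "f \<in> Hom X A B" and g: "g \<in> Hom X A C"
    by (auto simp: of_restrictional_def restr_le_def dest: Hom_unique)
  from perp have "(Rst X f', Rst X g') \<in> perp A"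
    by (simp add: of_restrictional_def)
  then have "(Rst X f, Rst X g) \<in> perp A"
    using Rst_in_restr_idems[OF f] Rst_in_restr_idems[OF g] Rst_mono[OF le(1)] Rst_mono[OF le(2)]
    by (rule perp_down)
  with f g show "(f, g) \<in> of_restrictional X perp A B C"
    by (simp add: of_restrictional_def)
next
  fix f g A B C h A' k B' k' C'
  assume perp: "(f, g) \<in> of_restrictional X perp A B C" and h: "h \<in> Hom X A' A"
    and k: "k \<in> Hom X B B'" and k': "k' \<in> Hom X C C'"
  then have f: "f \<in> Hom X A B" and g: "g \<in> Hom X A C" and fg: "(Rst X f, Rst X g) \<in> perp A"
    by (auto simp: of_restrictional_def)
  have hf: "h \<cdot> f \<in> Hom X A' B" and hg: "h \<cdot> g \<in> Hom X A' C"
    using Comp_Hom[OF h f] Comp_Hom[OF h g] by auto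
  have hfk: "h \<cdot> f \<cdot> k \<in> Hom X A' B'" and hgk': "h \<cdot> g \<cdot> k' \<in> Hom X A' C'"
    using Comp_Hom[OF hf k] Comp_Hom[OF hg k'] by auto
  have "(Rst X (h \<cdot> f), Rst X (h \<cdot> g)) \<in> perp A'"
    using perp_Comp[OF fg h] by (simp add: Rst_Comp_Rst[OF h f] Rst_Comp_Rst[OF h g])
  then have "(Rst X (h \<cdot> f \<cdot> k), Rst X (h \<cdot> g \<cdot> k')) \<in> perp A'"
    using Rst_in_restr_idems[OF hfk] Rst_in_restr_idems[OF hgk'] Rst_Comp_le[OF hf k]
      Rst_Comp_le[OF hg k'] by (rule perp_down)
  with hfk hgk' show "(h \<cdot> f \<cdot> k, h \<cdot> g \<cdot> k') \<in> of_restrictional X perp A' B' C'"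
    by (simp add: of_restrictional_def)
next
  fix f g A B C assume "(f, g) \<in> of_restrictional X perp A B C"
  then show "(Rst X f, Rst X g) \<in> of_restrictional X perp A A A"
    by (auto simp: of_restrictional_def Rst_Hom Rst_Rst)
qed

lemma to_of_restrictional: "to_restrictional X (of_restrictional X perp) = perp"
proof (intro ext set_eqI)
  fix A p
  show "p \<in> to_restrictional X (of_restrictional X perp) A \<longleftrightarrow> p \<in> perp A"
    \<comment> \<open>By typing, \<open>perp\<close> relates only restriction idempotents, and these
      are fixed by \<open>Rst X\<close>, so the round trip changes nothing.\<close>
    using perp_typed[of A]
    by (cases p) (auto simp: to_restrictional_def of_restrictional_def restr_idems_def)
qed

end

theorem proposition3p4:
  fixes X :: "('o, 'm, 'z) restriction_zero_data_scheme"
  assumes "restriction_zero_category X"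
  shows
    "bij_betw (to_restrictional X)
       {perp. interference_relation X perp} {perpO. restrictional_interference_relation X perpO} \<and>
     bij_betw (of_restrictional X)
       {perpO. restrictional_interference_relation X perpO} {perp. interference_relation X perp} \<and>
     (\<forall>perp. interference_relation X perp \<longrightarrow>
        of_restrictional X (to_restrictional X perp) = perp) \<and>
     (\<forall>perpO. restrictional_interference_relation X perpO \<longrightarrow>
        to_restrictional X (of_restrictional X perpO) = perpO)"
proof (intro conjI allI impI)
  show "bij_betw (to_restrictional X)
      {perp. interference_relation X perp} {perpO. restrictional_interference_relation X perpO}"
    \<comment> \<open>The two round-trip lemmas make each construction the inverse of the
      other.\<close>
    by (rule bij_betw_byWitness[where f' = "of_restrictional X"])
      (auto simp: interference_relation.of_to_restrictional
        restrictional_interference_relation.to_of_restrictional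
        interference_relation.restrictional_to_restrictional
        restrictional_interference_relation.interference_of_restrictional)
  show "bij_betw (of_restrictional X)
      {perpO. restrictional_interference_relation X perpO} {perp. interference_relation X perp}"
    by (rule bij_betw_byWitness[where f' = "to_restrictional X"])
      (auto simp: interference_relation.of_to_restrictional
        restrictional_interference_relation.to_of_restrictional
        interference_relation.restrictional_to_restrictional
        restrictional_interference_relation.interference_of_restrictional)
qed (simp_all add: interference_relation.of_to_restrictional
    restrictional_interference_relation.to_of_restrictional)

end
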